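(* Let $\mathit{init}_i\ge 0$ for $i\in[1..n]$ be the initial account balances of processes $p_1,\dots,p_n$. Put $C=\{\mathsf{mint}_{i,x}\}_{1\le i\le n,\,x\in\mathbb{R}_{\ge0}}$, $O_i=\{\mathsf{transfer}_{i,j,x}\}_{1\le j\le n,\,x\in\mathbb{R}_{\ge0}}$, $\Sigma=C\cup\bigcup_iO_i$. For a trace $v\in\mathbb{M}(\Sigma)$ let $$\mathsf{acc}(i,v)=\mathit{init}_i+\sum_{\mathsf{transfer}_{k,i,y}\in v}y+\sum_{\mathsf{mint}_{i,y}\in v}y-\sum_{\mathsf{transfer}_{i,k,y}\in v}y,$$ where the sums range over the occurrences (with multiplicity) in $v$ of letters of the indicated form (any $k$, any $y$). Let $Q=\{\mathsf{balance}_i\}_{1\le i\le n}$ with $\mathsf{balance}_i(v)=\mathsf{acc}(i,v)$, and $$L=\{v\in\mathbb{M}(\Sigma)\mid\forall i\in[1..n]:\ \mathsf{acc}(i,v)\ge0\}.$$ Then $(C,(O_j)_{j\in[1..n]},L,Q)$ specifies a Process-Commutative Object; that is, $L$ satisfies Initial emptiness, $C^*$-closure and $I$-diamond closure.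
   Context: $\mathsf{transfer}_{i,j,x}$ is the transfer of an amount $x$ from $p_i$ to $p_j$; $\mathsf{mint}_{i,x}$ creates an amount $x$ on $p_i$'s account. Both are silent updates (return a constant). Given pairwise disjoint sets of updates $C$ (common updates) and $O_1,\dots,O_n$ ($O_i$ exclusive to process $p_i$), let $\Sigma=C\cup\bigcup_i O_i$, $I=\Sigma\times\Sigma\setminus\bigcup_i(O_i\times O_i)$, let $\sim_I$ be the least congruence on $\Sigma^*$ with $ab\sim_I ba$ for $(a,b)\in I$, and let $\mathbb{M}(\Sigma)=\Sigma^*/{\sim_I}$ be the trace monoid, with concatenation $\oplus$ and empty trace $\epsilon$. A tuple $(C,(O_j)_j,L,Q)$, with $L\subseteq \mathbb{M}(\Sigma)$ and $Q$ a set of query functions $L\to\mathbb{V}$ ($\mathbb{V}$ a set of output values), specifies a Process-Commutative Object if: - *Initial emptiness*: $\epsilon\in L$; - *$C^*$-closure*: if $v\in L$ and $w$ is a trace all of whose letters are in $C$, then $v\oplus w\in L$; - *$I$-diamond closure*: for all $i$, $v\in L$, $\mathsf{op}_i\in O_i$ and every trace $z$ with all letters in $\Sigma\setminus O_i$, if $v\oplus \mathsf{op}_i\in L$ and $v\oplus z\in L$ then $v\oplus z\oplus \mathsf{op}_i\in L$. *)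

theory Defs
  imports Complex_Main "HOL-Library.Multiset" "HOL-Library.FuncSet" "HOL-Library.Disjoint_Sets"
begin

section \<open>Traces\<close>

text \<open>The least congruence on the free monoid \<^term>\<open>lists \<Sigma>\<close> that makes
  independent letters commute.\<close>

inductive_set trace_cong :: "'a set \<Rightarrow> ('a \<times> 'a) set \<Rightarrow> ('a list \<times> 'a list) set"
  for \<Sigma> :: "'a set" and I :: "('a \<times> 'a) set"
where
  swap: "(a, b) \<in> I \<Longrightarrow> ([a, b], [b, a]) \<in> trace_cong \<Sigma> I"
| refl: "u \<in> lists \<Sigma> \<Longrightarrow> (u, u) \<in> trace_cong \<Sigma> I"
| sym: "(u, v) \<in> trace_cong \<Sigma> I \<Longrightarrow> (v, u) \<in> trace_cong \<Sigma> I"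
| trans: "(u, v) \<in> trace_cong \<Sigma> I \<Longrightarrow> (v, w) \<in> trace_cong \<Sigma> I \<Longrightarrow> (u, w) \<in> trace_cong \<Sigma> I"
| append: "(u, u') \<in> trace_cong \<Sigma> I \<Longrightarrow> (v, v') \<in> trace_cong \<Sigma> I
    \<Longrightarrow> (u @ v, u' @ v') \<in> trace_cong \<Sigma> I"

type_synonym 'a trace = "'a list set"

definition traces :: "'a set \<Rightarrow> ('a \<times> 'a) set \<Rightarrow> 'a trace set" where
  "traces \<Sigma> I = lists \<Sigma> // trace_cong \<Sigma> I"

definition trace_of :: "'a set \<Rightarrow> ('a \<times> 'a) set \<Rightarrow> 'a list \<Rightarrow> 'a trace" where
  "trace_of \<Sigma> I u = trace_cong \<Sigma> I `` {u}"

definition trace_append :: "'a set \<Rightarrow> ('a \<times> 'a) set \<Rightarrow> 'a trace \<Rightarrow> 'a trace \<Rightarrow> 'a trace" where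
  "trace_append \<Sigma> I v w = (\<Union>x\<in>v. \<Union>y\<in>w. trace_of \<Sigma> I (x @ y))"

text \<open>All representatives of a trace have the same letters with the same multiplicities
  (\<open>mset_trace_cong\<close> below), so for a trace the image is a singleton.\<close>

definition trace_mset :: "'a trace \<Rightarrow> 'a multiset" where
  "trace_mset v = the_elem (mset ` v)"

abbreviation trace_letters :: "'a trace \<Rightarrow> 'a set" where
  "trace_letters v \<equiv> set_mset (trace_mset v)"

lemma mset_trace_cong: "(u, v) \<in> trace_cong \<Sigma> I \<Longrightarrow> mset u = mset v"
  by (induction rule: trace_cong.induct) auto

lemma trace_cong_in_lists:
  assumes "(u, v) \<in> trace_cong \<Sigma> I" "I \<subseteq> \<Sigma> \<times> \<Sigma>"
  shows "u \<in> lists \<Sigma> \<and> v \<in> lists \<Sigma>"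
  using assms by (induction rule: trace_cong.induct) auto

lemma equiv_trace_cong:
  assumes "I \<subseteq> \<Sigma> \<times> \<Sigma>"
  shows "equiv (lists \<Sigma>) (trace_cong \<Sigma> I)"
proof (rule equivI)
  show "trace_cong \<Sigma> I \<subseteq> lists \<Sigma> \<times> lists \<Sigma>"
    using trace_cong_in_lists[OF _ assms] by fast
  show "refl_on (lists \<Sigma>) (trace_cong \<Sigma> I)"
    by (rule refl_onI) (rule trace_cong.refl)
  show "Relation.sym (trace_cong \<Sigma> I)"
    by (rule symI) (rule trace_cong.sym)
  show "Relation.trans (trace_cong \<Sigma> I)"
    by (rule transI) (rule trace_cong.trans)
qed

lemma trace_mset_trace_of:
  assumes "u \<in> lists \<Sigma>"
  shows "trace_mset (trace_of \<Sigma> I u) = mset u"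
proof -
  have "mset ` trace_of \<Sigma> I u = {mset u}"
    using trace_cong.refl[OF assms, of I] by (auto simp: trace_of_def dest: mset_trace_cong)
  then show ?thesis
    by (simp add: trace_mset_def)
qed

lemma trace_append_trace_of:
  assumes "I \<subseteq> \<Sigma> \<times> \<Sigma>" "u \<in> lists \<Sigma>" "v \<in> lists \<Sigma>"
  shows "trace_append \<Sigma> I (trace_of \<Sigma> I u) (trace_of \<Sigma> I v) = trace_of \<Sigma> I (u @ v)"
proof -
  have *: "trace_of \<Sigma> I (x @ y) = trace_of \<Sigma> I (u @ v)"
    if "x \<in> trace_of \<Sigma> I u" "y \<in> trace_of \<Sigma> I v" for x y
  proof -
    have "(u @ v, x @ y) \<in> trace_cong \<Sigma> I"
      using that by (auto simp: trace_of_def intro: trace_cong.append)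
    then show ?thesis
      unfolding trace_of_def using equiv_class_eq[OF equiv_trace_cong[OF assms(1)]] by blast
  qed
  have "u \<in> trace_of \<Sigma> I u" "v \<in> trace_of \<Sigma> I v"
    using assms(2,3) by (auto simp: trace_of_def intro: trace_cong.refl)
  with * show ?thesis
    unfolding trace_append_def by blast
qed

section \<open>Process-commutative objects\<close>

text \<open>Processes are the numbers in \<open>{1..n}\<close>; \<open>C\<close> is the set of common updates and \<open>X i\<close>
  the set of updates exclusive to process \<open>i\<close>.\<close>

definition updates :: "nat \<Rightarrow> 'a set \<Rightarrow> (nat \<Rightarrow> 'a set) \<Rightarrow> 'a set" where
  "updates n C X = C \<union> (\<Union>i\<in>{1..n}. X i)"

definition indep :: "nat \<Rightarrow> 'a set \<Rightarrow> (nat \<Rightarrow> 'a set) \<Rightarrow> ('a \<times> 'a) set" where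
  "indep n C X = updates n C X \<times> updates n C X - (\<Union>i\<in>{1..n}. X i \<times> X i)"

definition object_traces :: "nat \<Rightarrow> 'a set \<Rightarrow> (nat \<Rightarrow> 'a set) \<Rightarrow> 'a trace set" where
  "object_traces n C X = traces (updates n C X) (indep n C X)"

definition object_trace_of :: "nat \<Rightarrow> 'a set \<Rightarrow> (nat \<Rightarrow> 'a set) \<Rightarrow> 'a list \<Rightarrow> 'a trace" where
  "object_trace_of n C X = trace_of (updates n C X) (indep n C X)"

definition object_append ::
    "nat \<Rightarrow> 'a set \<Rightarrow> (nat \<Rightarrow> 'a set) \<Rightarrow> 'a trace \<Rightarrow> 'a trace \<Rightarrow> 'a trace" where
  "object_append n C X = trace_append (updates n C X) (indep n C X)"

definition initial_emptiness ::
    "nat \<Rightarrow> 'a set \<Rightarrow> (nat \<Rightarrow> 'a set) \<Rightarrow> 'a trace set \<Rightarrow> bool" where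
  "initial_emptiness n C X L \<longleftrightarrow> object_trace_of n C X [] \<in> L"

definition common_closure ::
    "nat \<Rightarrow> 'a set \<Rightarrow> (nat \<Rightarrow> 'a set) \<Rightarrow> 'a trace set \<Rightarrow> bool" where
  "common_closure n C X L \<longleftrightarrow>
    (\<forall>v\<in>L. \<forall>w\<in>object_traces n C X. trace_letters w \<subseteq> C \<longrightarrow> object_append n C X v w \<in> L)"

definition diamond_closure ::
    "nat \<Rightarrow> 'a set \<Rightarrow> (nat \<Rightarrow> 'a set) \<Rightarrow> 'a trace set \<Rightarrow> bool" where
  "diamond_closure n C X L \<longleftrightarrow>
    (\<forall>i\<in>{1..n}. \<forall>v\<in>L. \<forall>a\<in>X i. \<forall>z\<in>object_traces n C X.
      trace_letters z \<subseteq> updates n C X - X i \<longrightarrow>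
      object_append n C X v (object_trace_of n C X [a]) \<in> L \<longrightarrow>
      object_append n C X v z \<in> L \<longrightarrow>
      object_append n C X (object_append n C X v z) (object_trace_of n C X [a]) \<in> L)"

text \<open>The set of output values is the type \<^typ>\<open>'v\<close>. A query with domain \<open>L\<close> is
  represented by a function that is \<^const>\<open>undefined\<close> outside \<open>L\<close>.\<close>

definition process_commutative_object ::
    "nat \<Rightarrow> 'a set \<Rightarrow> (nat \<Rightarrow> 'a set) \<Rightarrow> 'a trace set \<Rightarrow> ('a trace \<Rightarrow> 'v) set \<Rightarrow> bool" where
  "process_commutative_object n C X L Q \<longleftrightarrow>
    disjoint_family_on X {1..n} \<and> (\<forall>i\<in>{1..n}. C \<inter> X i = {}) \<and>
    L \<subseteq> object_traces n C X \<and>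
    Q \<subseteq> (L \<rightarrow>\<^sub>E UNIV) \<and>
    initial_emptiness n C X L \<and> common_closure n C X L \<and> diamond_closure n C X L"

section \<open>Asset transfer with minting\<close>

datatype asset_update =
    Mint nat (amount: real)
  | Transfer nat nat (amount: real)

definition mints :: "nat \<Rightarrow> asset_update set" where
  "mints n = {Mint i x |i x. i \<in> {1..n} \<and> 0 \<le> x}"

definition transfers :: "nat \<Rightarrow> nat \<Rightarrow> asset_update set" where
  "transfers n i = {Transfer i j x |j x. j \<in> {1..n} \<and> 0 \<le> x}"

definition acc :: "(nat \<Rightarrow> real) \<Rightarrow> nat \<Rightarrow> asset_update trace \<Rightarrow> real" where
  "acc init i v = init i
    + (\<Sum>a\<in>#{#a \<in># trace_mset v. \<exists>k y. a = Transfer k i y#}. amount a)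
    + (\<Sum>a\<in>#{#a \<in># trace_mset v. \<exists>y. a = Mint i y#}. amount a)
    - (\<Sum>a\<in>#{#a \<in># trace_mset v. \<exists>k y. a = Transfer i k y#}. amount a)"

definition asset_traces :: "nat \<Rightarrow> (nat \<Rightarrow> real) \<Rightarrow> asset_update trace set" where
  "asset_traces n init =
    {v \<in> object_traces n (mints n) (transfers n). \<forall>i\<in>{1..n}. 0 \<le> acc init i v}"

definition balance ::
    "nat \<Rightarrow> (nat \<Rightarrow> real) \<Rightarrow> nat \<Rightarrow> asset_update trace \<Rightarrow> real" where
  "balance n init i = restrict (acc init i) (asset_traces n init)"

end

theory Submission
  imports Defs
begin

text \<open>A letter outside \<open>transfers n i\<close> never decreases the balance of process \<open>i\<close>. Hence after
  \<open>v\<close>, \<open>z\<close> and a letter \<open>a \<in> transfers n i\<close> the balance of \<open>i\<close> is at least its balance after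
  \<open>v\<close> and \<open>a\<close>, while the balance of any other process is at least its balance after \<open>v\<close> and \<open>z\<close>.\<close>

lemma indep_subset: "indep n C X \<subseteq> updates n C X \<times> updates n C X"
  unfolding indep_def by blast

lemma object_tracesE:
  assumes "v \<in> object_traces n C X"
  obtains u where "u \<in> lists (updates n C X)" "v = object_trace_of n C X u"
proof -
  obtain u where "u \<in> lists (updates n C X)"
      "v = trace_cong (updates n C X) (indep n C X) `` {u}"
    using assms unfolding object_traces_def traces_def by (rule quotientE)
  then show ?thesis
    using that unfolding object_trace_of_def trace_of_def by blast
qed

lemma object_trace_of_in_object_traces:
  "u \<in> lists (updates n C X) \<Longrightarrow> object_trace_of n C X u \<in> object_traces n C X"
  unfolding object_traces_def traces_def object_trace_of_def trace_of_def
  by (rule quotientI)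

lemma trace_mset_object_trace_of:
  "u \<in> lists (updates n C X) \<Longrightarrow> trace_mset (object_trace_of n C X u) = mset u"
  unfolding object_trace_of_def by (rule trace_mset_trace_of)

lemma trace_letters_subset_updates:
  assumes "v \<in> object_traces n C X"
  shows "trace_letters v \<subseteq> updates n C X"
proof -
  obtain u where "u \<in> lists (updates n C X)" "v = object_trace_of n C X u"
    using assms by (rule object_tracesE)
  then show ?thesis
    by (simp add: trace_mset_object_trace_of lists_eq_set)
qed

lemma object_append_object_trace_of:
  assumes "u \<in> lists (updates n C X)" "w \<in> lists (updates n C X)"
  shows "object_append n C X (object_trace_of n C X u) (object_trace_of n C X w) =
    object_trace_of n C X (u @ w)"
  unfolding object_append_def object_trace_of_def
  using assms by (rule trace_append_trace_of[OF indep_subset])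

text \<open>Representative words reduce both claims to list append. The multiset part lets the
  closure proofs argue about letter counts without returning to words.\<close>

lemma
  assumes "v \<in> object_traces n C X" "w \<in> object_traces n C X"
  shows object_append_in_object_traces: "object_append n C X v w \<in> object_traces n C X"
    and trace_mset_object_append:
      "trace_mset (object_append n C X v w) = trace_mset v + trace_mset w"
proof -
  obtain s t where "s \<in> lists (updates n C X)" "v = object_trace_of n C X s"
      "t \<in> lists (updates n C X)" "w = object_trace_of n C X t"
    using assms by (meson object_tracesE)
  moreover from this have "s @ t \<in> lists (updates n C X)"
    by simp
  ultimately show "object_append n C X v w \<in> object_traces n C X"
    and "trace_mset (object_append n C X v w) = trace_mset v + trace_mset w"
    by (simp_all add: object_append_object_trace_of object_trace_of_in_object_traces
        trace_mset_object_trace_of del: append_in_lists_conv)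
qed

text \<open>The trace-dependent part of \<open>acc\<close>, taken on multisets so that it is
  additive. A self-transfer \<open>Transfer i i y\<close> occurs in both the first and the last sum
  and cancels.\<close>

definition balance_change :: "nat \<Rightarrow> asset_update multiset \<Rightarrow> real" where
  "balance_change i M =
    (\<Sum>a\<in>#{#a \<in># M. \<exists>k y. a = Transfer k i y#}. amount a)
    + (\<Sum>a\<in>#{#a \<in># M. \<exists>y. a = Mint i y#}. amount a)
    - (\<Sum>a\<in>#{#a \<in># M. \<exists>k y. a = Transfer i k y#}. amount a)"

lemma acc_eq: "acc init i v = init i + balance_change i (trace_mset v)"
  unfolding acc_def balance_change_def by simp

lemma balance_change_add: "balance_change i (M + N) = balance_change i M + balance_change i N"
  unfolding balance_change_def by simp

lemma amount_nonneg: "a \<in> updates n (mints n) (transfers n) \<Longrightarrow> 0 \<le> amount a"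
  unfolding updates_def mints_def transfers_def by auto

text \<open>The constructor and its first argument determine which set of updates a letter belongs
  to. So a multiset of updates that avoids \<open>transfers n i\<close> contains no debit of
  \<open>i\<close>.\<close>

lemma transfer_in_transfers:
  "Transfer i k y \<in> updates n (mints n) (transfers n) \<Longrightarrow> Transfer i k y \<in> transfers n i"
  unfolding updates_def mints_def transfers_def by auto

text \<open>Only transfers out of \<open>i\<close> contribute negatively, and excluding
  \<open>transfers n i\<close> leaves none; the credits have nonnegative amounts.\<close>

lemma balance_change_nonneg:
  assumes "set_mset M \<subseteq> updates n (mints n) (transfers n) - transfers n i"
  shows "0 \<le> balance_change i M"
proof -
  have "{#a \<in># M. \<exists>k y. a = Transfer i k y#} = {#}"
    using assms transfer_in_transfers by auto
  moreover have "0 \<le> (\<Sum>a\<in>#filter_mset P M. amount a)" for P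
  proof -
    \<comment> \<open>Termwise comparison with a sum of zeros, since nonnegativity is known only for
      letters of \<open>M\<close>.\<close>
    have "(\<Sum>a\<in>#filter_mset P M. 0) \<le> (\<Sum>a\<in>#filter_mset P M. amount a)"
      using assms by (intro sum_mset_mono) (auto intro: amount_nonneg)
    then show ?thesis
      by simp
  qed
  ultimately show ?thesis
    unfolding balance_change_def by (simp only: image_mset_empty sum_mset.empty) simp
qed

lemma disjoint_family_transfers: "disjoint_family_on (transfers n) S"
  unfolding disjoint_family_on_def transfers_def by auto

lemma mints_transfers_disjoint: "mints n \<inter> transfers n i = {}"
  unfolding mints_def transfers_def by auto

text \<open>Without letters there are no credits or debits, so every balance is the initial one;
  here the assumption on \<open>init\<close> enters.\<close>

lemma initial_emptiness_asset_traces: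
  assumes "\<forall>i\<in>{1..n}. 0 \<le> init i"
  shows "initial_emptiness n (mints n) (transfers n) (asset_traces n init)"
  using assms unfolding initial_emptiness_def asset_traces_def
  by (simp add: object_trace_of_in_object_traces acc_eq trace_mset_object_trace_of
      balance_change_def)

text \<open>A mint belongs to no \<open>transfers n i\<close>, so \<open>w\<close> contains no debit
  and every account keeps at least its balance after \<open>v\<close>.\<close>

lemma common_closure_asset_traces:
  "common_closure n (mints n) (transfers n) (asset_traces n init)"
  unfolding common_closure_def
proof (intro ballI impI)
  fix v w
  assume v: "v \<in> asset_traces n init" and w: "w \<in> object_traces n (mints n) (transfers n)"
    and mint: "trace_letters w \<subseteq> mints n"
  have "0 \<le> balance_change i (trace_mset w)" for i
    using mint mints_transfers_disjoint trace_letters_subset_updates[OF w]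
    by (intro balance_change_nonneg[of _ n]) blast
  \<comment> \<open>Reassociation isolates \<open>init i + balance_change i (trace_mset v)\<close>,
    which is the nonnegative \<open>acc init i v\<close>.\<close>
  with v w show "object_append n (mints n) (transfers n) v w \<in> asset_traces n init"
    unfolding asset_traces_def
    by (auto simp: object_append_in_object_traces acc_eq trace_mset_object_append
        balance_change_add add.assoc[symmetric])
qed

lemma diamond_closure_asset_traces:
  "diamond_closure n (mints n) (transfers n) (asset_traces n init)"
  unfolding diamond_closure_def
proof (intro ballI impI)
  let ?U = "updates n (mints n) (transfers n)"
  let ?T = "object_traces n (mints n) (transfers n)"
  let ?app = "object_append n (mints n) (transfers n)"
  fix i v a z
  let ?a = "object_trace_of n (mints n) (transfers n) [a]"
  assume i: "i \<in> {1..n}" and "v \<in> asset_traces n init" and a: "a \<in> transfers n i" and z: "z \<in> ?T"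
    and letters: "trace_letters z \<subseteq> ?U - transfers n i"
    and va: "?app v ?a \<in> asset_traces n init" and vz: "?app v z \<in> asset_traces n init"
  have v: "v \<in> ?T"
    using \<open>v \<in> asset_traces n init\<close> unfolding asset_traces_def by simp
  have aU: "a \<in> ?U"
    using a i unfolding updates_def by blast
  have aT: "?a \<in> ?T" and mset_a: "trace_mset ?a = {#a#}"
    using aU by (simp_all add: object_trace_of_in_object_traces trace_mset_object_trace_of)
  \<comment> \<open>Additivity makes the contributions of \<open>z\<close> and \<open>a\<close>
    independent of their order, so the balance after \<open>v\<close>, \<open>z\<close>,
    \<open>a\<close> can be compared with the one after \<open>v\<close>, \<open>a\<close>.\<close>
  have acc_append: "acc init k (?app x y) = acc init k x + balance_change k (trace_mset y)"
    if "x \<in> ?T" "y \<in> ?T" for k x y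
    using that by (simp add: acc_eq trace_mset_object_append balance_change_add)
  have "0 \<le> acc init k (?app (?app v z) ?a)" if k: "k \<in> {1..n}" for k
  proof (cases "k = i")
    case True
    \<comment> \<open>This balance already covers the debit made by \<open>a\<close>;
      \<open>z\<close> can only add to it.\<close>
    have "0 \<le> acc init i (?app v ?a)"
      using va i unfolding asset_traces_def by blast
    moreover have "0 \<le> balance_change i (trace_mset z)"
      using letters by (rule balance_change_nonneg)
    ultimately show ?thesis
      using True v z aT by (simp add: acc_append object_append_in_object_traces)
  next
    case False
    have "0 \<le> acc init k (?app v z)"
      using vz k unfolding asset_traces_def by blast
    \<comment> \<open>The debit of \<open>a\<close> falls on \<open>i\<close>, so any other account
      is credited or left unchanged.\<close>
    moreover have "a \<notin> transfers n k"
      using a False unfolding transfers_def by auto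
    then have "0 \<le> balance_change k (trace_mset ?a)"
      using aU by (intro balance_change_nonneg[of _ n]) (simp add: mset_a)
    ultimately show ?thesis
      using v z aT by (simp add: acc_append object_append_in_object_traces)
  qed
  then show "?app (?app v z) ?a \<in> asset_traces n init"
    unfolding asset_traces_def using v z aT by (simp add: object_append_in_object_traces)
qed

theorem theorem5:
  fixes n :: nat and init :: "nat \<Rightarrow> real"
  assumes "\<forall>i\<in>{1..n}. 0 \<le> init i"
  shows "process_commutative_object n (mints n) (transfers n)
    (asset_traces n init) {balance n init i |i. i \<in> {1..n}}"
proof -
  have "asset_traces n init \<subseteq> object_traces n (mints n) (transfers n)"
    unfolding asset_traces_def by blast
  \<comment> \<open>\<open>balance\<close> is a \<open>restrict\<close>, hence
    \<open>undefined\<close> outside \<open>asset_traces n init\<close>, as the extensional function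
    space demands.\<close>
  moreover have "{balance n init i |i. i \<in> {1..n}} \<subseteq> asset_traces n init \<rightarrow>\<^sub>E UNIV"
    unfolding balance_def by auto
  ultimately show ?thesis
    using assms disjoint_family_transfers mints_transfers_disjoint initial_emptiness_asset_traces
      common_closure_asset_traces diamond_closure_asset_traces
    by (simp add: process_commutative_object_def)
qed

end
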